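(* Let $W\in\mathbb{R}^{n\times n}$ be symmetric positive definite, let $T\in\mathbb{R}^{n\times n}$ be symmetric positive semidefinite, and let $$0\leqslant \mu_1\leqslant\cdots\leqslant\mu_r<1\leqslant\mu_{r+1}\leqslant\cdots\leqslant\mu_n$$ be the eigenvalues (counted with multiplicity) of $S=W^{-\frac12}TW^{-\frac12}$, where $1\le r<n$. For $\alpha,\beta>0$ let $$\mathcal{G}_{\alpha,\beta}=(W+\beta T)^{-1}(T-\beta W)(\alpha W+T)^{-1}(W-\alpha T).$$ If $\alpha$ and $\beta$ satisfy $$\frac{1-\mu_1}{1+\mu_1}<\alpha<\frac{\mu_n+1}{\mu_n-1}\quad\text{and}\quad \frac{\mu_n-1}{\mu_n+1}<\beta<\frac{1+\mu_1}{1-\mu_1}$$ (where the upper bound on $\alpha$ is read as $+\infty$ when $\mu_n=1$), then the TTSCSP iteration method is convergent, i.e. $\rho(\mathcal{G}_{\alpha,\beta})<1$.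
   Context: Consider the complex linear system $Au=(W+iT)u=b$, $b\in\mathbb{C}^n$, $i=\sqrt{-1}$. For positive numbers $\alpha,\beta$, the TTSCSP (two-parameter two-step scale-splitting) iteration method starts from an arbitrary $u^{(0)}\in\mathbb{C}^n$ and computes, for $k=0,1,2,\ldots$, $$(\alpha W+T)u^{(k+\frac12)}=i(W-\alpha T)u^{(k)}+(\alpha-i)b,$$ $$(W+\beta T)u^{(k+1)}=i(\beta W-T)u^{(k+\frac12)}+(1-\beta i)b.$$ Equivalently $u^{(k+1)}=\mathcal{G}_{\alpha,\beta}u^{(k)}+\mathcal{C}_{\alpha,\beta}$ with iteration matrix $\mathcal{G}_{\alpha,\beta}$ and $\mathcal{C}_{\alpha,\beta}=(\alpha+\beta)(W+\beta T)^{-1}(W-iT)(\alpha W+T)^{-1}b$. The method is called convergent if $\rho(\mathcal{G}_{\alpha,\beta})<1$, where $\rho$ denotes the spectral radius. *)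

theory Defs
  imports "Jordan_Normal_Form.Spectral_Radius" "Jordan_Normal_Form.Gauss_Jordan_Elimination"
begin

definition sym_pos_def :: "nat \<Rightarrow> real mat \<Rightarrow> bool" where
  "sym_pos_def n A \<longleftrightarrow> A \<in> carrier_mat n n \<and> transpose_mat A = A \<and>
     (\<forall>v\<in>carrier_vec n. v \<noteq> 0\<^sub>v n \<longrightarrow> v \<bullet> (A *\<^sub>v v) > 0)"

definition sym_pos_semidef :: "nat \<Rightarrow> real mat \<Rightarrow> bool" where
  "sym_pos_semidef n A \<longleftrightarrow> A \<in> carrier_mat n n \<and> transpose_mat A = A \<and>
     (\<forall>v\<in>carrier_vec n. v \<bullet> (A *\<^sub>v v) \<ge> 0)"

(* The result is unspecified if A is not invertible; all uses below are on positive
   definite matrices. *)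
definition mat_inv :: "real mat \<Rightarrow> real mat" where
  "mat_inv A = the (mat_inverse A)"

(* The principal square root: the unique symmetric positive semidefinite R with R^2 = A.
   It exists, and is unique, for every symmetric positive semidefinite A. *)
definition mat_sqrt :: "real mat \<Rightarrow> real mat" where
  "mat_sqrt A = (THE R. sym_pos_semidef (dim_row A) R \<and> R * R = A)"

(* S = W^(-1/2) T W^(-1/2) *)
definition scaled_mat :: "real mat \<Rightarrow> real mat \<Rightarrow> real mat" where
  "scaled_mat W T = mat_inv (mat_sqrt W) * T * mat_inv (mat_sqrt W)"

(* The iteration matrix obtained by eliminating the half step from
     (\<alpha> W + T) u' = \<i> (W - \<alpha> T) u + (\<alpha> - \<i>) b,
     (W + \<beta> T) u'' = \<i> (\<beta> W - T) u' + (1 - \<beta> \<i>) b.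
   The two factors \<i> multiply to -1, which turns \<beta> W - T into T - \<beta> W, so the
   matrix is real. *)
definition ttscsp_iteration_mat :: "real mat \<Rightarrow> real mat \<Rightarrow> real \<Rightarrow> real \<Rightarrow> real mat" where
  "ttscsp_iteration_mat W T \<alpha> \<beta> =
     mat_inv (W + \<beta> \<cdot>\<^sub>m T) * (T - \<beta> \<cdot>\<^sub>m W) * mat_inv (\<alpha> \<cdot>\<^sub>m W + T) * (W - \<alpha> \<cdot>\<^sub>m T)"

definition ttscsp_convergent :: "real mat \<Rightarrow> real mat \<Rightarrow> real \<Rightarrow> real \<Rightarrow> bool" where
  "ttscsp_convergent W T \<alpha> \<beta> \<longleftrightarrow>
     spectral_radius (map_mat complex_of_real (ttscsp_iteration_mat W T \<alpha> \<beta>)) < 1"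

end

theory Submission
  imports Defs
begin

text \<open>
  Write \<open>W = R\<^sup>2\<close> with the positive semidefinite root \<open>R\<close> and diagonalize the symmetric matrix
  \<open>S = R\<^sup>-\<^sup>1 T R\<^sup>-\<^sup>1 = P D P\<^sup>T\<close> with \<open>P\<close> orthogonal. Then \<open>L = R P\<close> reduces both
  matrices at once by congruence: \<open>W = L L\<^sup>T\<close> and \<open>T = L D L\<^sup>T\<close>
  (\<open>simultaneous_diagonalization\<close>). Every factor of the iteration matrix is a linear combination of
  \<open>W\<close> and \<open>T\<close> or the inverse of one, and the factors alternate, so the matrices \<open>L\<close> and \<open>L\<^sup>T\<close>
  cancel between neighbours. The iteration matrix is thus similar to the diagonal matrix with entries
  \<open>(\<mu> - \<beta>) / (1 + \<beta> \<mu>) * ((1 - \<alpha> \<mu>) / (\<alpha> + \<mu>))\<close>, where \<open>\<mu>\<close> runs through the eigenvalues of \<open>S\<close>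
  (\<open>ttscsp_iteration_mat_diagonalization\<close>). These entries are the eigenvalues, and the bounds on
  \<open>\<alpha>\<close> and \<open>\<beta>\<close> say exactly that each of the two fractions stays in \<open>(-1, 1)\<close> when \<open>\<mu>\<close> runs between
  \<open>\<mu> 1\<close> and \<open>\<mu> n\<close> (\<open>abs_ttscsp_factor_less_1\<close>).

  Two classical facts underlie this. The spectral theorem for real symmetric matrices is
  proved by deflation: a Householder reflection moves a unit eigenvector to the first coordinate
  vector, which splits off a one-by-one block. The existence and uniqueness of the principal square
  root then follow by reading everything on an orthonormal eigenbasis.
\<close>

section \<open>The spectral theorem for real symmetric matrices\<close>

text \<open>
  The reflection \<open>I - 2 w w\<^sup>T / (w\<^sup>T w)\<close> in the hyperplane orthogonal to the difference \<open>w\<close> of \<open>v\<close>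
  and the first coordinate vector exchanges these two unit vectors.
\<close>

lemma householder_reflection:
  fixes v :: "real vec"
  assumes v: "v \<in> carrier_vec (Suc n)" and unit: "v \<bullet> v = 1"
  obtains U where "U \<in> carrier_mat (Suc n) (Suc n)" "transpose_mat U = U"
    "U * U = 1\<^sub>m (Suc n)" "U *\<^sub>v unit_vec (Suc n) 0 = v"
proof -
  define w where "w i = v $ i - (if i = 0 then 1 else 0)" for i
  define c where "c = 1 / (1 - v $ 0)"
  (* This is 2 / (w . w), because w . w = 2 - 2 * v $ 0. If v is the first coordinate vector, then
     division by zero makes c = 0 and U the identity, which is the reflection wanted there. *)
  define U where "U = mat (Suc n) (Suc n) (\<lambda>(i, j). (if i = j then 1 else 0) - c * w i * w j)"
  have sq: "(\<Sum>i = 0..<Suc n. v $ i * v $ i) = 1"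
    using unit v unfolding scalar_prod_def by simp
  have "(\<Sum>i = 0..<Suc n. w i * w i)
      = (\<Sum>i = 0..<Suc n. v $ i * v $ i - (if i = 0 then 2 * v $ 0 - 1 else 0))"
    by (rule sum.cong) (auto simp: w_def algebra_simps)
  also have "\<dots> = 2 - 2 * v $ 0"
    using sq by (simp add: sum_subtractf del: sum.op_ivl_Suc)
  finally have ww: "(\<Sum>i = 0..<Suc n. w i * w i) = 2 - 2 * v $ 0" .
  have w_zero: "w i = 0" if "v $ 0 = 1" "i < Suc n" for i
  proof -
    have "(\<Sum>i = 0..<Suc n. w i * w i) = 0" using ww that(1) by simp
    then have "\<forall>i\<in>{0..<Suc n}. w i * w i = 0"
      by (subst (asm) sum_nonneg_eq_0_iff) auto
    then show ?thesis using that(2) by auto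
  qed
  have c_ww: "c * c * (\<Sum>i = 0..<Suc n. w i * w i) = 2 * c"
    unfolding ww c_def by (simp add: divide_simps)
  have U: "U \<in> carrier_mat (Suc n) (Suc n)" unfolding U_def by simp
  moreover have "transpose_mat U = U" by (rule eq_matI) (auto simp: U_def)
  moreover have "U * U = 1\<^sub>m (Suc n)"
  proof (rule eq_matI)
    fix i j assume ij: "i < dim_row (1\<^sub>m (Suc n) :: real mat)" "j < dim_col (1\<^sub>m (Suc n) :: real mat)"
    let ?\<delta> = "\<lambda>a b. if a = b then 1 else (0 :: real)"
    have "(U * U) $$ (i, j)
        = (\<Sum>k = 0..<Suc n. (?\<delta> i k - c * w i * w k) * (?\<delta> k j - c * w k * w j))"
      using ij by (simp add: U_def scalar_prod_def del: sum.op_ivl_Suc)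
    also have "\<dots> = (\<Sum>k = 0..<Suc n. (if k = i then ?\<delta> i j - c * w i * w j else 0)
        - (if k = j then c * w i * w j else 0) + w i * w j * (c * c * (w k * w k)))"
      by (rule sum.cong) (auto simp: algebra_simps)
    also have "\<dots> = ?\<delta> i j - 2 * c * w i * w j
        + w i * w j * (c * c * (\<Sum>k = 0..<Suc n. w k * w k))"
      using ij by (simp add: sum.distrib sum_subtractf sum_distrib_left del: sum.op_ivl_Suc)
    also have "\<dots> = ?\<delta> i j" unfolding c_ww by simp
    finally show "(U * U) $$ (i, j) = 1\<^sub>m (Suc n) $$ (i, j)" using ij by simp
  qed (simp_all add: U_def)
  moreover have "U *\<^sub>v unit_vec (Suc n) 0 = v"
  proof (rule eq_vecI)
    fix i assume i: "i < dim_vec v"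
    have "(U *\<^sub>v unit_vec (Suc n) 0) $ i = U $$ (i, 0)"
      using i v U by simp
    also have "\<dots> = v $ i"
      using i v w_zero[of i]
      by (cases "v $ 0 = 1") (auto simp: U_def w_def c_def field_simps)
    finally show "(U *\<^sub>v unit_vec (Suc n) 0) $ i = v $ i" .
  qed (use v in \<open>simp add: U_def\<close>)
  ultimately show thesis by (rule that)
qed

text \<open>
  Over the complex numbers an eigenvalue exists, and it is real because
  \<open>k (v \<bullet>c v) = (A v) \<bullet>c v = v \<bullet>c (A v) = cnj k (v \<bullet>c v)\<close>; so it is already a root of the real
  characteristic polynomial.
\<close>
lemma symmetric_real_eigenvalue_exists:
  fixes A :: "real mat"
  assumes A: "A \<in> carrier_mat n n" and sym: "transpose_mat A = A" and n: "n > 0"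
  obtains k where "eigenvalue A k"
proof -
  let ?A = "map_mat complex_of_real A"
  have cA: "?A \<in> carrier_mat n n" using A by simp
  obtain k where "eigenvalue ?A k"
    using spectrum_non_empty[OF cA] n unfolding spectrum_def by auto
  then obtain v where v: "v \<in> carrier_vec n" "v \<noteq> 0\<^sub>v n" and Av: "?A *\<^sub>v v = k \<cdot>\<^sub>v v"
    using cA unfolding eigenvalue_def eigenvector_def by auto
  have conjA: "?A *\<^sub>v conjugate v = conjugate (?A *\<^sub>v v)"
    using A v by (intro eq_vecI) (auto simp: scalar_prod_def sum_conjugate conjugate_dist_mul)
  have symA: "transpose_mat ?A = ?A" using sym
    by (metis map_mat_transpose)
  have "k * (v \<bullet>c v) = (?A *\<^sub>v v) \<bullet>c v" unfolding Av using v by simp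
  also have "\<dots> = v \<bullet> (?A *\<^sub>v conjugate v)"
    using transpose_vec_mult_scalar[OF cA, of "conjugate v" v] v symA 
    by (metis assms(1) cA carrier_vec_conjugate comm_scalar_prod mult_mat_vec_carrier)
  also have "\<dots> = cnj k * (v \<bullet>c v)" unfolding conjA Av using v
    by (simp add: conjugate_smult_vec)
  finally have "k = cnj k" using conjugate_square_eq_0_vec[OF v(1)] v(2) by auto
  then have k: "k = complex_of_real (Re k)" by (simp add: complex_eq_iff)
  have "poly (map_poly complex_of_real (char_poly A)) (complex_of_real (Re k)) = 0"
    using \<open>eigenvalue ?A k\<close> k unfolding eigenvalue_root_char_poly[OF cA] of_real_hom.char_poly_hom[OF A] by simp
  then have "poly (char_poly A) (Re k) = 0"
    by (simp add: of_real_hom.poly_map_poly)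
  then show thesis using that unfolding eigenvalue_root_char_poly[OF A, symmetric] by blast
qed

text \<open>
  Induction on the dimension. If \<open>U\<close> is the reflection that exchanges a unit eigenvector with the
  first coordinate vector, then \<open>U A U\<close> has that coordinate vector as an eigenvector; by symmetry
  its first row vanishes off the diagonal as well, and the induction hypothesis applies to the
  remaining block.
\<close>
theorem spectral_theorem_real_symmetric:
  fixes A :: "real mat"
  assumes "A \<in> carrier_mat n n" and "transpose_mat A = A"
  obtains P d where "P \<in> carrier_mat n n" "transpose_mat P * P = 1\<^sub>m n"
    "A = P * mat_diag n d * transpose_mat P"
proof -
  have "\<exists>P d. P \<in> carrier_mat n n \<and> transpose_mat P * P = 1\<^sub>m n
      \<and> A = P * mat_diag n d * transpose_mat P"
    using assms
  proof (induction n arbitrary: A)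
    case 0
    then show ?case by (intro exI[of _ "1\<^sub>m 0"] exI[of _ "\<lambda>_. 0"]) auto
  next
    case (Suc n)
    let ?m = "Suc n"
    note A = Suc.prems(1) and sym = Suc.prems(2)
    note [simp] = assoc_mult_mat[of _ ?m ?m _ ?m _ ?m] mult_carrier_mat[of _ ?m ?m _ ?m]
    right_mult_one_mat[of _ ?m ?m] left_mult_one_mat[of _ ?m ?m]
    obtain k where "eigenvalue A k"
      using symmetric_real_eigenvalue_exists[OF A sym] by auto
    then obtain x where x: "x \<in> carrier_vec ?m" "x \<noteq> 0\<^sub>v ?m" "A *\<^sub>v x = k \<cdot>\<^sub>v x"
      using A unfolding eigenvalue_def eigenvector_def by auto
    have xx: "x \<bullet> x > 0" using x conjugate_square_greater_0_vec[of x ?m] by (simp add: scalar_prod_def)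
    define v where "v = (1 / sqrt (x \<bullet> x)) \<cdot>\<^sub>v x"
    have v: "v \<in> carrier_vec ?m" using x by (simp add: v_def)
    have "v \<bullet> v = 1" using x xx by (simp add: v_def)
    then obtain U where U: "U \<in> carrier_mat ?m ?m" and Usym: "transpose_mat U = U"
      and UU: "U * U = 1\<^sub>m ?m" and Ue: "U *\<^sub>v unit_vec ?m 0 = v"
      using householder_reflection[OF v] by blast
    have Av: "A *\<^sub>v v = k \<cdot>\<^sub>v v"
      using x A by (simp add: v_def mult_mat_vec smult_smult_assoc mult.commute)
    have Uv: "U *\<^sub>v v = unit_vec ?m 0"
      unfolding Ue[symmetric] using U UU
      by (simp add: assoc_mult_mat_vec[of _ ?m ?m _ ?m, symmetric])
    define B where "B = U * A * U"
    have B: "B \<in> carrier_mat ?m ?m" using U A by (simp add: B_def)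
    have Bsym: "transpose_mat B = B"
      using U A sym Usym by (simp add: B_def transpose_mult[of _ ?m ?m _ ?m])
    have eB: "B *\<^sub>v unit_vec ?m 0 = k \<cdot>\<^sub>v unit_vec ?m 0"
      using U A v by (simp add: B_def assoc_mult_mat_vec[of _ ?m ?m _ ?m] Ue Av Uv mult_mat_vec
          del: assoc_mult_mat)
    have col0: "B $$ (i, 0) = (if i = 0 then k else 0)" if "i < ?m" for i
    proof -
      have "B $$ (i, 0) = (B *\<^sub>v unit_vec ?m 0) $ i" using that B by simp
      also have "\<dots> = (k \<cdot>\<^sub>v unit_vec ?m 0) $ i" by (simp only: eB)
      finally show ?thesis using that by simp
    qed
    have row0: "B $$ (0, i) = (if i = 0 then k else 0)" if "i < ?m" for i
      using col0[OF that] that B Bsym by (metis carrier_matD index_transpose_mat(1) zero_less_Suc)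
    define A' where "A' = mat n n (\<lambda>(i, j). B $$ (Suc i, Suc j))"
    have A': "A' \<in> carrier_mat n n" by (simp add: A'_def)
    have "transpose_mat A' = A'"
    proof (rule eq_matI)
      fix i j assume "i < dim_row A'" "j < dim_col A'"
      then have "B $$ (Suc j, Suc i) = B $$ (Suc i, Suc j)"
        using B Bsym A' by (metis Suc_less_eq carrier_matD index_transpose_mat(1))
      then show "transpose_mat A' $$ (i, j) = A' $$ (i, j)"
        using \<open>i < dim_row A'\<close> \<open>j < dim_col A'\<close> by (simp add: A'_def)
    qed (simp_all add: A'_def)
    then obtain Q d where Q: "Q \<in> carrier_mat n n" and QQ: "transpose_mat Q * Q = 1\<^sub>m n"
      and AQ: "A' = Q * mat_diag n d * transpose_mat Q"
      using Suc.IH[OF A'] by blast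
    (* Bordering Q by a one-by-one identity block gives an orthogonal matrix that diagonalizes B. *)
    define E where "E = four_block_mat (1\<^sub>m 1) (0\<^sub>m 1 n) (0\<^sub>m n 1) Q"
    define D where "D = mat_diag ?m (case_nat k d)"
    have D: "D = four_block_mat (mat 1 1 (\<lambda>_. k)) (0\<^sub>m 1 n) (0\<^sub>m n 1) (mat_diag n d)"
      by (rule eq_matI) (auto simp: D_def mat_diag_def split: nat.split)
    have B_block: "B = four_block_mat (mat 1 1 (\<lambda>_. k)) (0\<^sub>m 1 n) (0\<^sub>m n 1) A'"
      using B col0 row0 by (intro eq_matI) (auto simp: A'_def)
    have Et: "transpose_mat E = four_block_mat (1\<^sub>m 1) (0\<^sub>m 1 n) (0\<^sub>m n 1) (transpose_mat Q)"
      unfolding E_def using Q by (subst transpose_four_block_mat[of _ 1 1 _ n _ n]) auto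
    have E: "E \<in> carrier_mat ?m ?m" using Q by (auto simp: E_def)
    have Dc: "D \<in> carrier_mat ?m ?m" by (simp add: D_def)
    have EE: "transpose_mat E * E = 1\<^sub>m ?m"
      unfolding Et unfolding E_def using Q QQ
      by (subst mult_four_block_mat[of _ 1 1 _ n _ n _ _ 1 _ n]) (auto intro!: eq_matI)
    have EDE: "E * D * transpose_mat E = B"
      unfolding Et D B_block AQ unfolding E_def using Q 
      by (simp add: mult_four_block_mat[of _ 1 1 _ n _ n _ _ 1 _ n] mult_carrier_mat[of _ n n _ n]
          left_mult_zero_mat[of _ n n] right_mult_zero_mat[of _ n n])
    define P where "P = U * E"
    have P: "P \<in> carrier_mat ?m ?m" using U E by (simp add: P_def)
    have Pt: "transpose_mat P = transpose_mat E * U"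
      using U E Usym by (simp add: P_def transpose_mult[of _ ?m ?m _ ?m])
    have "transpose_mat P * P = transpose_mat E * (U * U) * E"
      unfolding Pt using U E by (simp add: P_def)
    also have "\<dots> = 1\<^sub>m ?m" using UU EE E by simp
    finally have PP: "transpose_mat P * P = 1\<^sub>m ?m" .
    have "P * D * transpose_mat P = U * (E * D * transpose_mat E) * U"
      unfolding Pt using U E Dc by (simp add: P_def)
    also have "\<dots> = (U * U) * A * (U * U)" unfolding EDE B_def using U A by simp
    also have "\<dots> = A" using UU A by simp
    finally show ?case using P PP unfolding D_def by metis
  qed
  then show thesis using that by blast
qed

lemma orthogonal_mat_right_inverse:
  fixes P :: "real mat"
  assumes "P \<in> carrier_mat n n" "transpose_mat P * P = 1\<^sub>m n"
  shows "P * transpose_mat P = 1\<^sub>m n"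
  using mat_mult_left_right_inverse[of "transpose_mat P" n P] assms by simp

section \<open>The principal square root of a positive definite matrix\<close>

text \<open>
  Since \<open>(R + s I) (R - s I) v = 0\<close>, the vector \<open>y = R v - s v\<close> satisfies \<open>R y = - s y\<close>. As \<open>R\<close> has
  no negative eigenvalue, \<open>y = 0\<close>.
\<close>
lemma pos_semidef_sqrt_eigenvector:
  assumes R: "sym_pos_semidef n R" and v: "v \<in> carrier_vec n" and s: "s > 0"
    and RRv: "(R * R) *\<^sub>v v = s\<^sup>2 \<cdot>\<^sub>v v"
  shows "R *\<^sub>v v = s \<cdot>\<^sub>v v"
proof -
  have Rc: "R \<in> carrier_mat n n" using R by (simp add: sym_pos_semidef_def)
  define y where "y = R *\<^sub>v v - s \<cdot>\<^sub>v v"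
  have y: "y \<in> carrier_vec n" using Rc v by (simp add: y_def)
  have "R *\<^sub>v y = (R * R) *\<^sub>v v - s \<cdot>\<^sub>v (R *\<^sub>v v)"
    using Rc v by (simp add: y_def mult_minus_distrib_mat_vec[of _ n n] mult_mat_vec)
  also have "\<dots> = (- s) \<cdot>\<^sub>v y"
    unfolding RRv y_def using Rc v by (intro eq_vecI) (auto simp: power2_eq_square algebra_simps)
  finally have "y \<bullet> (R *\<^sub>v y) = - s * (y \<bullet> y)" using y by simp
  moreover have "y \<bullet> (R *\<^sub>v y) \<ge> 0" using R y by (simp add: sym_pos_semidef_def)
  moreover have "y \<bullet> y \<ge> 0" by (auto simp: scalar_prod_def intro: sum_nonneg)
  ultimately have "y \<bullet> y = 0" using s by (smt (verit) mult_minus_left mult_pos_pos)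
  then have "y = 0\<^sub>v n" using conjugate_square_eq_0_vec[OF y] by (simp add: scalar_prod_def)
  then have "y $ i = 0" if "i < n" for i using that by simp
  then show ?thesis using Rc v by (intro eq_vecI) (auto simp: y_def)
qed

lemma mat_diag_cong:
  assumes "\<And>i. i < n \<Longrightarrow> f i = g i"
  shows "mat_diag n f = mat_diag n g"
  using assms by (intro eq_matI) (auto simp: mat_diag_def)

text \<open>
  Taking the roots of the eigenvalues in a diagonalization \<open>W = P D P\<^sup>T\<close> gives a square root.
  Any other positive semidefinite root \<open>R'\<close> acts on each column of \<open>P\<close> as multiplication by the root
  of its eigenvalue, by \<open>pos_semidef_sqrt_eigenvector\<close>, and therefore coincides with it. Uniqueness
  is as essential as existence here, since the principal root is given by a definite description.
\<close>
lemma mat_sqrt_pos_def: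
  assumes W: "sym_pos_def n W"
  shows "sym_pos_semidef n (mat_sqrt W)" and "mat_sqrt W * mat_sqrt W = W"
proof -
  note [simp] = assoc_mult_mat[of _ n n _ n _ n] mult_carrier_mat[of _ n n _ n]
    right_mult_one_mat[of _ n n] left_mult_one_mat[of _ n n]
  have Wc: "W \<in> carrier_mat n n" and sym: "transpose_mat W = W"
    using W by (auto simp: sym_pos_def_def)
  obtain P d where P: "P \<in> carrier_mat n n" and PP: "transpose_mat P * P = 1\<^sub>m n"
    and WP: "W = P * mat_diag n d * transpose_mat P"
    using spectral_theorem_real_symmetric[OF Wc sym] by blast
  note PPt = orthogonal_mat_right_inverse[OF P PP]
  have "W * P = P * mat_diag n d * (transpose_mat P * P)" unfolding WP using P by simp
  then have WP': "W * P = P * mat_diag n d" using PP P by simp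
  have col_diag: "col (P * mat_diag n f) i = f i \<cdot>\<^sub>v col P i" if "i < n" for f i
    using P that by (intro eq_vecI) (auto simp: mat_diag_mult_right)
  have eig: "W *\<^sub>v col P i = d i \<cdot>\<^sub>v col P i" if "i < n" for i
    using col_diag[OF that, of d] WP' that P Wc by (metis carrier_matD(2) col_mult2)
  have unit: "col P i \<bullet> col P i = 1" if "i < n" for i
    using arg_cong[OF PP, of "\<lambda>M. M $$ (i, i)"] that P by simp
  have d: "d i > 0" if "i < n" for i
  proof -
    have c: "col P i \<in> carrier_vec n" using that P by simp
    then have "col P i \<noteq> 0\<^sub>v n" using unit[OF that] by auto
    then have "col P i \<bullet> (W *\<^sub>v col P i) > 0" using W c by (simp add: sym_pos_def_def)
    then show ?thesis using eig[OF that] unit[OF that] c by simp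
  qed
  define R where "R = P * mat_diag n (\<lambda>i. sqrt (d i)) * transpose_mat P"
  have Rc: "R \<in> carrier_mat n n" using P by (simp add: R_def)
  have diag_sym: "transpose_mat (mat_diag n f) = mat_diag n f" for f :: "nat \<Rightarrow> real"
    by (rule eq_matI) (auto simp: mat_diag_def)
  have Rsym: "transpose_mat R = R"
    using P by (simp add: R_def transpose_mult[of _ n n _ n] diag_sym)
  have "R * R = P * mat_diag n (\<lambda>i. sqrt (d i)) * (transpose_mat P * P)
      * mat_diag n (\<lambda>i. sqrt (d i)) * transpose_mat P"
    using P by (simp add: R_def)
  also have "\<dots> = P * (mat_diag n (\<lambda>i. sqrt (d i)) * mat_diag n (\<lambda>i. sqrt (d i))) * transpose_mat P"
    unfolding PP using P by (simp del: mat_diag_diag)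
  also have "mat_diag n (\<lambda>i. sqrt (d i)) * mat_diag n (\<lambda>i. sqrt (d i)) = mat_diag n d"
    unfolding mat_diag_diag using d by (intro mat_diag_cong) (simp add: less_imp_le)
  finally have RR: "R * R = W" unfolding WP .
  have "v \<bullet> (R *\<^sub>v v) \<ge> 0" if v: "v \<in> carrier_vec n" for v
  proof -
    define y where "y = transpose_mat P *\<^sub>v v"
    have y: "y \<in> carrier_vec n" using P v by (simp add: y_def)
    have "v \<bullet> (R *\<^sub>v v) = v \<bullet> (P *\<^sub>v (mat_diag n (\<lambda>i. sqrt (d i)) *\<^sub>v y))"
      using P v by (simp add: R_def y_def assoc_mult_mat_vec[of _ n n _ n] del: assoc_mult_mat)
    also have "\<dots> = y \<bullet> (mat_diag n (\<lambda>i. sqrt (d i)) *\<^sub>v y)"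
      unfolding y_def using transpose_vec_mult_scalar[OF P _ v] P v
      by (metis mat_diag_dim mult_mat_vec_carrier transpose_carrier_mat)
    also have "\<dots> = (\<Sum>i = 0..<n. y $ i * (sqrt (d i) * y $ i))"
      unfolding scalar_prod_def using y
      by (intro sum.cong) (auto simp: mat_diag_def scalar_prod_def if_distrib[where f="\<lambda>x. x * _"] cong: if_cong)
    also have "\<dots> \<ge> 0" using d
      by (intro sum_nonneg) (auto simp: less_imp_le mult.left_commute[of "y $ _"])
    finally show ?thesis .
  qed
  then have "sym_pos_semidef n R" using Rc Rsym by (simp add: sym_pos_semidef_def)
  moreover have "R' = R" if R': "sym_pos_semidef n R'" and RR': "R' * R' = W" for R'
  proof -
    have R'c: "R' \<in> carrier_mat n n" using R' by (simp add: sym_pos_semidef_def)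
    have "R' * P = P * mat_diag n (\<lambda>i. sqrt (d i))"
    proof (rule mat_col_eqI)
      fix i assume "i < dim_col (P * mat_diag n (\<lambda>i. sqrt (d i)))"
      then have i: "i < n" by (simp add: mat_diag_def)
      have "R' *\<^sub>v col P i = sqrt (d i) \<cdot>\<^sub>v col P i"
        using pos_semidef_sqrt_eigenvector[OF R', of "col P i" "sqrt (d i)"] d[OF i] eig[OF i] P i RR'
        by simp
      then show "col (R' * P) i = col (P * mat_diag n (\<lambda>i. sqrt (d i))) i"
        using col_diag[OF i] col_mult2[OF R'c P i] by simp
    qed (use R'c P in \<open>auto simp: mat_diag_def\<close>)
    then have "R' * (P * transpose_mat P) = R"
      unfolding R_def using R'c P by (metis assoc_mult_mat transpose_carrier_mat)
    then show ?thesis using PPt R'c by simp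
  qed
  ultimately have "\<exists>!R. sym_pos_semidef n R \<and> R * R = W"
    using RR by blast
  from theI'[OF this] show "sym_pos_semidef n (mat_sqrt W)" "mat_sqrt W * mat_sqrt W = W"
    unfolding mat_sqrt_def carrier_matD(1)[OF Wc] by blast+
qed

section \<open>Inverse matrices\<close>

lemma mat_inv_eqI:
  assumes A: "A \<in> carrier_mat n n" and B: "B \<in> carrier_mat n n" and AB: "A * B = 1\<^sub>m n"
  shows "mat_inv A = B"
proof -
  have BA: "B * A = 1\<^sub>m n" by (rule mat_mult_left_right_inverse[OF A B AB])
  have "A \<in> Units (ring_mat TYPE(real) n ())"
    using A B AB BA by (auto simp: Units_def ring_mat_def)
  then obtain C where C: "mat_inverse A = Some C"
    using mat_inverse(1)[OF A, where b = "()"] by (cases "mat_inverse A") auto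
  from mat_inverse(2)[OF A C] have AC: "A * C = 1\<^sub>m n" "C \<in> carrier_mat n n" by auto
  have "C = B * A * C" using BA AC by simp
  also have "\<dots> = B" using AC A B by (simp add: assoc_mult_mat[of _ n n _ n _ n])
  finally show ?thesis by (simp add: mat_inv_def C)
qed

lemma mat_inv_inverts:
  assumes A: "A \<in> carrier_mat n n"
    and inj: "\<And>v. v \<in> carrier_vec n \<Longrightarrow> A *\<^sub>v v = 0\<^sub>v n \<Longrightarrow> v = 0\<^sub>v n"
  shows "mat_inv A \<in> carrier_mat n n" "A * mat_inv A = 1\<^sub>m n" "mat_inv A * A = 1\<^sub>m n"
proof -
  have "det A \<noteq> 0" using det_0_iff_vec_prod_zero_field[OF A] inj by auto
  then obtain B where "mat_inverse A = Some B"
    using mat_inverse(1)[OF A, where b = "()"] det_non_zero_imp_unit[OF A, where b = "()"] by (cases "mat_inverse A") auto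
  then show "mat_inv A \<in> carrier_mat n n" "A * mat_inv A = 1\<^sub>m n" "mat_inv A * A = 1\<^sub>m n"
    using mat_inverse(2)[OF A] by (auto simp: mat_inv_def)
qed

section \<open>Diagonalization of the iteration matrix\<close>

text \<open>
  The pencil of \<open>W\<close> and \<open>T\<close> is brought to diagonal form by the congruence with \<open>L = R P\<close>, where
  \<open>R\<close> is the principal root of \<open>W\<close> and the columns of \<open>P\<close> are an orthonormal eigenbasis of the scaled
  matrix. The matrix \<open>M\<close> is the inverse of \<open>L\<close>.
\<close>
lemma simultaneous_diagonalization:
  assumes W: "sym_pos_def n W" and T: "T \<in> carrier_mat n n" "transpose_mat T = T"
  obtains L M d where "L \<in> carrier_mat n n" "M \<in> carrier_mat n n" "L * M = 1\<^sub>m n" "M * L = 1\<^sub>m n"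
    "W = L * transpose_mat L" "T = L * mat_diag n d * transpose_mat L"
    "\<And>i. i < n \<Longrightarrow> poly (char_poly (scaled_mat W T)) (d i) = 0"
proof -
  note [simp] = assoc_mult_mat[of _ n n _ n _ n] mult_carrier_mat[of _ n n _ n]
    right_mult_one_mat[of _ n n] left_mult_one_mat[of _ n n]
  define R where "R = mat_sqrt W"
  have "sym_pos_semidef n R" and RR: "R * R = W"
    using mat_sqrt_pos_def[OF W] by (auto simp: R_def)
  then have R: "R \<in> carrier_mat n n" and Rsym: "transpose_mat R = R"
    by (auto simp: sym_pos_semidef_def)
  have inj: "v = 0\<^sub>v n" if v: "v \<in> carrier_vec n" and Rv: "R *\<^sub>v v = 0\<^sub>v n" for v
  proof (rule ccontr)
    assume "v \<noteq> 0\<^sub>v n"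
    moreover have "W *\<^sub>v v = 0\<^sub>v n" unfolding RR[symmetric] using R v Rv by auto
    ultimately show False using W v by (auto simp: sym_pos_def_def)
  qed
  define Ri where "Ri = mat_inv R"
  have Ri: "Ri \<in> carrier_mat n n" and RRi: "R * Ri = 1\<^sub>m n" and RiR: "Ri * R = 1\<^sub>m n"
    using mat_inv_inverts[OF R inj] by (auto simp: Ri_def)
  have "transpose_mat Ri = transpose_mat Ri * (R * Ri)" using RRi Ri by simp
  also have "\<dots> = transpose_mat (R * Ri) * Ri" using R Ri Rsym by (simp add: transpose_mult[of _ n n _ n])
  also have "\<dots> = Ri" using RRi Ri by simp
  finally have Risym: "transpose_mat Ri = Ri" .
  define S where "S = scaled_mat W T"
  have S_eq: "S = Ri * T * Ri" by (simp add: S_def scaled_mat_def Ri_def R_def)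
  have S: "S \<in> carrier_mat n n" using Ri T by (simp add: S_eq)
  have Ssym: "transpose_mat S = S"
    using Ri T Risym by (simp add: S_eq transpose_mult[of _ n n _ n])
  obtain P d where P: "P \<in> carrier_mat n n" and PP: "transpose_mat P * P = 1\<^sub>m n"
    and SP: "S = P * mat_diag n d * transpose_mat P"
    using spectral_theorem_real_symmetric[OF S Ssym] by blast
  note PPt = orthogonal_mat_right_inverse[OF P PP]
  define L where "L = R * P"
  define M where "M = transpose_mat P * Ri"
  have L: "L \<in> carrier_mat n n" and M: "M \<in> carrier_mat n n" using R P Ri by (auto simp: L_def M_def)
  have Lt: "transpose_mat L = transpose_mat P * R"
    using R P Rsym by (simp add: L_def transpose_mult[of _ n n _ n])
  have "L * M = R * (P * transpose_mat P) * Ri" using R P Ri by (simp add: L_def M_def)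
  also have "\<dots> = 1\<^sub>m n" using PPt R RRi by simp
  finally have LM: "L * M = 1\<^sub>m n" .
  have "L * transpose_mat L = R * (P * transpose_mat P) * R" unfolding Lt using R P by (simp add: L_def)
  also have "\<dots> = W" using PPt R RR by simp
  finally have WL: "W = L * transpose_mat L" ..
  have "L * mat_diag n d * transpose_mat L = R * S * R" unfolding Lt SP using R P by (simp add: L_def)
  also have "\<dots> = (R * Ri) * T * (Ri * R)" unfolding S_eq using R Ri T by simp
  also have "\<dots> = T" using RRi RiR T by simp
  finally have TL: "T = L * mat_diag n d * transpose_mat L" ..
  have "similar_mat S (mat_diag n d)"
    by (rule similar_matI[of _ _ _ _ n]) (use S P PP PPt SP in auto)
  then have cp: "char_poly S = (\<Prod>a\<leftarrow>diag_mat (mat_diag n d). [:- a, 1:])"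
    by (subst char_poly_similar, assumption, intro char_poly_upper_triangular[of _ n])
       (auto simp: mat_diag_def)
  have root: "poly (char_poly S) (d i) = 0" if "i < n" for i
    unfolding cp using that by (auto simp: poly_prod_list diag_mat_def mat_diag_def prod_list_zero_iff)
  show thesis
    by (rule that[OF L M LM mat_mult_left_right_inverse[OF L M LM] WL TL root[unfolded S_def]])
qed

lemma spectral_radius_similar_diag:
  fixes G :: "real mat"
  assumes G: "G \<in> carrier_mat n n" and n: "n > 0"
    and sim: "similar_mat G (mat_diag n g)" and g: "\<And>i. i < n \<Longrightarrow> \<bar>g i\<bar> < c"
  shows "spectral_radius (map_mat complex_of_real G) < c"
proof -
  let ?G = "map_mat complex_of_real G"
  have Gc: "?G \<in> carrier_mat n n" using G by simp
  obtain k where "k \<in> spectrum ?G" and k: "spectral_radius ?G = norm k"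
    using spectral_radius_mem_max(1)[OF Gc n] by auto
  then have root: "poly (map_poly of_real (char_poly G)) k = 0"
    unfolding spectrum_root_char_poly[OF Gc] of_real_hom.char_poly_hom[OF G] by simp
  have "map_poly complex_of_real (char_poly G)
      = char_poly (map_mat complex_of_real (mat_diag n g))"
    unfolding char_poly_similar[OF sim] of_real_hom.char_poly_hom[OF mat_diag_dim] ..
  also have "map_mat complex_of_real (mat_diag n g) = mat_diag n (\<lambda>i. complex_of_real (g i))"
    by (rule eq_matI) (auto simp: mat_diag_def)
  also have "char_poly \<dots> = (\<Prod>a\<leftarrow>diag_mat (mat_diag n (\<lambda>i. complex_of_real (g i))). [:- a, 1:])"
    by (intro char_poly_upper_triangular[of _ n]) (auto simp: mat_diag_def)
  finally have "\<exists>i<n. k = of_real (g i)"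
    using root by (auto simp: diag_mat_def mat_diag_def poly_prod_list prod_list_zero_iff)
  then show ?thesis using g k by auto
qed

text \<open>
  The matrices \<open>C f = L diag(f) L\<^sup>T\<close> form a linear space that contains \<open>W\<close> and \<open>T\<close>, and the inverse
  of \<open>C f\<close> is \<open>K (1/f)\<close> with \<open>K f = L\<^sup>-\<^sup>T diag(f) L\<^sup>-\<^sup>1\<close>. In the product \<open>K * C * K * C\<close> the inner
  factors cancel and leave \<open>L\<^sup>-\<^sup>T diag(g) L\<^sup>T\<close>: a congruence of the pencil becomes a similarity of
  the iteration matrix.
\<close>
lemma ttscsp_iteration_mat_diagonalization:
  assumes L: "L \<in> carrier_mat n n" and M: "M \<in> carrier_mat n n"
    and LM: "L * M = 1\<^sub>m n" and M_L: "M * L = 1\<^sub>m n"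
    and W: "W = L * transpose_mat L" and T: "T = L * mat_diag n d * transpose_mat L"
    and nz: "\<And>i. i < n \<Longrightarrow> 1 + \<beta> * d i \<noteq> 0" "\<And>i. i < n \<Longrightarrow> \<alpha> + d i \<noteq> 0"
  shows "ttscsp_iteration_mat W T \<alpha> \<beta> \<in> carrier_mat n n"
    and "similar_mat (ttscsp_iteration_mat W T \<alpha> \<beta>)
      (mat_diag n (\<lambda>i. (d i - \<beta>) / (1 + \<beta> * d i) * ((1 - \<alpha> * d i) / (\<alpha> + d i))))"
proof -
  note [simp] = assoc_mult_mat[of _ n n _ n _ n] mult_carrier_mat[of _ n n _ n]
    right_mult_one_mat[of _ n n] left_mult_one_mat[of _ n n]
  define C where "C f = L * mat_diag n f * transpose_mat L" for f
  define K where "K f = transpose_mat M * mat_diag n f * M" for f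
  have C: "C f \<in> carrier_mat n n" and K: "K f \<in> carrier_mat n n" for f using L M by (auto simp: C_def K_def)
  have Cd: "C f $$ (i, j) = (\<Sum>k = 0..<n. L $$ (i, k) * f k * L $$ (j, k))" if "i < n" "j < n" for f i j
    unfolding C_def using L that by (subst mat_diag_mult_right[OF L]) (simp add: scalar_prod_def)
  have WC: "W = C (\<lambda>_. 1)" and TC: "T = C d" using L by (auto simp: C_def W T)
  have X: "W + \<beta> \<cdot>\<^sub>m T = C (\<lambda>i. 1 + \<beta> * d i)" "T - \<beta> \<cdot>\<^sub>m W = C (\<lambda>i. d i - \<beta>)"
    "\<alpha> \<cdot>\<^sub>m W + T = C (\<lambda>i. \<alpha> + d i)" "W - \<alpha> \<cdot>\<^sub>m T = C (\<lambda>i. 1 - \<alpha> * d i)"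
    unfolding WC TC using carrier_matD[OF C]
    by (auto intro!: eq_matI simp: Cd algebra_simps sum.distrib sum_subtractf sum_distrib_left)
  have LMt: "transpose_mat L * transpose_mat M = 1\<^sub>m n" and MLt: "transpose_mat M * transpose_mat L = 1\<^sub>m n"
    using LM M_L L M by (metis transpose_mult transpose_one)+
  have inv: "mat_inv (C f) = K (\<lambda>i. 1 / f i)" if "\<And>i. i < n \<Longrightarrow> f i \<noteq> 0" for f
  proof (rule mat_inv_eqI[OF C K])
    have "C f * K (\<lambda>i. 1 / f i)
        = L * mat_diag n f * (transpose_mat L * transpose_mat M) * mat_diag n (\<lambda>i. 1 / f i) * M"
      using L M by (simp add: C_def K_def)
    also have "\<dots> = L * (mat_diag n f * mat_diag n (\<lambda>i. 1 / f i)) * M"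
      unfolding LMt using L M by (simp del: mat_diag_diag)
    also have "mat_diag n f * mat_diag n (\<lambda>i. 1 / f i) = 1\<^sub>m n"
      unfolding mat_diag_diag mat_diag_one[symmetric] using that by (intro mat_diag_cong) simp
    finally show "C f * K (\<lambda>i. 1 / f i) = 1\<^sub>m n" using L LM by simp
  qed
  have KC: "K f * C g = transpose_mat M * mat_diag n (\<lambda>i. f i * g i) * transpose_mat L" for f g
  proof -
    have "K f * C g = transpose_mat M * mat_diag n f * (M * L) * mat_diag n g * transpose_mat L"
      using L M by (simp add: C_def K_def)
    also have "\<dots> = transpose_mat M * (mat_diag n f * mat_diag n g) * transpose_mat L"
      unfolding M_L using L M by (simp del: mat_diag_diag)
    finally show ?thesis by simp
  qed
  let ?f = "\<lambda>i. 1 / (1 + \<beta> * d i) * (d i - \<beta>)" and ?h = "\<lambda>i. 1 / (\<alpha> + d i) * (1 - \<alpha> * d i)"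
  let ?g = "\<lambda>i. (d i - \<beta>) / (1 + \<beta> * d i) * ((1 - \<alpha> * d i) / (\<alpha> + d i))"
  have "ttscsp_iteration_mat W T \<alpha> \<beta>
      = (K (\<lambda>i. 1 / (1 + \<beta> * d i)) * C (\<lambda>i. d i - \<beta>)) * (K (\<lambda>i. 1 / (\<alpha> + d i)) * C (\<lambda>i. 1 - \<alpha> * d i))"
    unfolding ttscsp_iteration_mat_def X using nz C K by (simp add: inv)
  also have "\<dots> = transpose_mat M * mat_diag n ?f * (transpose_mat L * transpose_mat M)
      * mat_diag n ?h * transpose_mat L"
    unfolding KC using L M by simp
  also have "\<dots> = transpose_mat M * (mat_diag n ?f * mat_diag n ?h) * transpose_mat L"
    unfolding LMt using L M by (simp del: mat_diag_diag)
  also have "mat_diag n ?f * mat_diag n ?h = mat_diag n ?g" by simp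
  finally have G: "ttscsp_iteration_mat W T \<alpha> \<beta> = transpose_mat M * mat_diag n ?g * transpose_mat L" .
  show *: "ttscsp_iteration_mat W T \<alpha> \<beta> \<in> carrier_mat n n" unfolding G using L M by simp
  show "similar_mat (ttscsp_iteration_mat W T \<alpha> \<beta>) (mat_diag n ?g)"
    by (rule similar_matI[OF _ MLt LMt G]) (use * L M in auto)
qed

section \<open>Convergence\<close>

text \<open>
  As the denominators are positive, each fraction lies in \<open>(-1, 1)\<close> iff two inequalities that
  are affine in \<open>\<mu>\<close> hold. The lower bound on \<open>\<alpha>\<close> and the upper bound on \<open>\<beta>\<close> are two of them at \<open>lo\<close>, and they persist for larger \<open>\<mu>\<close> because
  their slopes are positive. The other two are the remaining bounds at \<open>hi\<close>; they have the form
  \<open>a * \<mu> < b\<close> with \<open>b > 0\<close>, and hence hold for all \<open>\<mu>\<close> between \<open>0\<close> and \<open>hi\<close> when they hold at \<open>hi\<close>.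
\<close>
lemma abs_ttscsp_factor_less_1:
  fixes \<alpha> \<beta> \<mu> lo hi :: real
  assumes "0 \<le> lo" "lo \<le> \<mu>" "\<mu> \<le> hi" "lo < 1" "1 \<le> hi" "\<alpha> > 0" "\<beta> > 0"
    and a1: "(1 - lo) / (1 + lo) < \<alpha>" and a2: "hi \<noteq> 1 \<Longrightarrow> \<alpha> < (hi + 1) / (hi - 1)"
    and b1: "(hi - 1) / (hi + 1) < \<beta>" and b2: "\<beta> < (1 + lo) / (1 - lo)"
  shows "\<bar>(\<mu> - \<beta>) / (1 + \<beta> * \<mu>) * ((1 - \<alpha> * \<mu>) / (\<alpha> + \<mu>))\<bar> < 1"
proof -
  have affine: "a * \<mu> < b" if "0 \<le> lo" "lo \<le> \<mu>" "\<mu> \<le> hi" "a * hi < b" "0 < b" for a b :: real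
  proof (cases "a \<le> 0")
    case True
    then have "a * \<mu> \<le> 0" using that by (intro mult_nonpos_nonneg) auto
    then show ?thesis using that by simp
  next
    case False
    then have "a * \<mu> \<le> a * hi" using that by simp
    then show ?thesis using that by simp
  qed
  have pos: "1 + \<beta> * \<mu> > 0" "\<alpha> + \<mu> > 0"
    using assms mult_nonneg_nonneg[of \<beta> \<mu>] by linarith+
  have "1 - lo < \<alpha> * (1 + lo)" using a1 assms by (simp add: divide_less_eq)
  moreover have "(1 + \<alpha>) * lo \<le> (1 + \<alpha>) * \<mu>" using assms by (intro mult_left_mono) auto
  ultimately have A1: "1 - \<alpha> * \<mu> < \<alpha> + \<mu>" by (simp add: algebra_simps)
  have "\<alpha> * (hi - 1) < hi + 1"
    using a2 assms by (cases "hi = 1") (auto simp: less_divide_eq)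
  then have "(\<alpha> - 1) * \<mu> < \<alpha> + 1"
    by (intro affine[OF \<open>0 \<le> lo\<close> \<open>lo \<le> \<mu>\<close> \<open>\<mu> \<le> hi\<close>]) (use assms in \<open>auto simp: algebra_simps\<close>)
  then have A2: "\<alpha> * \<mu> - 1 < \<alpha> + \<mu>" by (simp add: algebra_simps)
  have "hi - 1 < \<beta> * (hi + 1)" using b1 assms by (simp add: divide_less_eq)
  then have "(1 - \<beta>) * \<mu> < \<beta> + 1"
    by (intro affine[OF \<open>0 \<le> lo\<close> \<open>lo \<le> \<mu>\<close> \<open>\<mu> \<le> hi\<close>]) (use assms in \<open>auto simp: algebra_simps\<close>)
  then have B1: "\<mu> - \<beta> < 1 + \<beta> * \<mu>" by (simp add: algebra_simps)
  have "\<beta> * (1 - lo) < 1 + lo" using b2 assms by (simp add: less_divide_eq)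
  moreover have "(1 + \<beta>) * lo \<le> (1 + \<beta>) * \<mu>" using assms by (intro mult_left_mono) auto
  ultimately have B2: "\<beta> - \<mu> < 1 + \<beta> * \<mu>" by (simp add: algebra_simps)
  have "\<bar>(\<mu> - \<beta>) / (1 + \<beta> * \<mu>)\<bar> < 1" "\<bar>(1 - \<alpha> * \<mu>) / (\<alpha> + \<mu>)\<bar> < 1"
    using pos A1 A2 B1 B2 by (auto simp: abs_less_iff divide_less_eq minus_divide_left)
  then show ?thesis unfolding abs_mult
    by (metis abs_ge_zero mult_strict_mono' mult_1)
qed

theorem theorem1:
  fixes W T :: "real mat" and n r :: nat and \<mu> :: "nat \<Rightarrow> real" and \<alpha> \<beta> :: real
  assumes "sym_pos_def n W"
    and "sym_pos_semidef n T"
    and "char_poly (scaled_mat W T) = (\<Prod>i=1..n. [:- \<mu> i, 1:])"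
    and "mono_on {1..n} \<mu>"
    and "1 \<le> r" and "r < n"
    and "0 \<le> \<mu> 1" and "\<mu> r < 1" and "1 \<le> \<mu> (r + 1)"
    and "\<alpha> > 0" and "\<beta> > 0"
    and "(1 - \<mu> 1) / (1 + \<mu> 1) < \<alpha>"
    and "\<mu> n \<noteq> 1 \<Longrightarrow> \<alpha> < (\<mu> n + 1) / (\<mu> n - 1)"
    and "(\<mu> n - 1) / (\<mu> n + 1) < \<beta>"
    and "\<beta> < (1 + \<mu> 1) / (1 - \<mu> 1)"
  shows "ttscsp_convergent W T \<alpha> \<beta>"
proof -
  have T: "T \<in> carrier_mat n n" "transpose_mat T = T"
    using assms(2) by (auto simp: sym_pos_semidef_def)
  obtain L M d where LM: "L \<in> carrier_mat n n" "M \<in> carrier_mat n n" "L * M = 1\<^sub>m n" "M * L = 1\<^sub>m n"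
    "W = L * transpose_mat L" "T = L * mat_diag n d * transpose_mat L"
    and root: "\<And>i. i < n \<Longrightarrow> poly (char_poly (scaled_mat W T)) (d i) = 0"
    by (rule simultaneous_diagonalization[OF assms(1) T]) blast
  have mono: "\<mu> i \<le> \<mu> j" if "1 \<le> i" "i \<le> j" "j \<le> n" for i j
    using monotone_onD[OF assms(4), of i j] that by auto
  have lo: "\<mu> 1 < 1" using mono[of 1 r] assms by linarith
  have hi: "1 \<le> \<mu> n" using mono[of "r + 1" n] assms by linarith
  have range: "\<mu> 1 \<le> d i" "d i \<le> \<mu> n" if i: "i < n" for i
  proof -
    obtain j where "j \<in> {1..n}" "d i = \<mu> j"
      using root[OF i] by (auto simp: assms(3) poly_prod)
    then show "\<mu> 1 \<le> d i" "d i \<le> \<mu> n" using mono by auto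
  qed
  let ?g = "\<lambda>i. (d i - \<beta>) / (1 + \<beta> * d i) * ((1 - \<alpha> * d i) / (\<alpha> + d i))"
  have "1 + \<beta> * d i \<noteq> 0" "\<alpha> + d i \<noteq> 0" if "i < n" for i
    using range(1)[OF that] assms(7,10,11) mult_nonneg_nonneg[of \<beta> "d i"] by linarith+
  note G = ttscsp_iteration_mat_diagonalization[OF LM this]
  have bound: "\<bar>?g i\<bar> < 1" if "i < n" for i
    using abs_ttscsp_factor_less_1[OF assms(7) range[OF that] lo hi assms(10,11,12,13,14,15)] .
  have n: "0 < n" using \<open>r < n\<close> by simp
  have Gc: "ttscsp_iteration_mat W T \<alpha> \<beta> \<in> carrier_mat n n" by (rule G(1))
  have Gs: "similar_mat (ttscsp_iteration_mat W T \<alpha> \<beta>) (mat_diag n ?g)" by (rule G(2))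
  show ?thesis
    unfolding ttscsp_convergent_def by (rule spectral_radius_similar_diag[OF Gc n Gs bound])
qed

end
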